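(* Let $T_1,T_2$ be trees with $n$ vertices such that $T_2$ covers $T_1$ in $\mathsf{GTS}_n$. Then for all $q\in\mathbb{R}$ with $|q|>1$, $\lambda_{\min}(\mathcal{L}_{T_1}^q)\ge\lambda_{\min}(\mathcal{L}_{T_2}^q)$.
   Context: For a tree $T$ with degree diagonal matrix $D$ and adjacency matrix $A$, $\mathcal{L}_T^q=I+q^2(D-I)-qA$; $\lambda_{\min}$ is its smallest eigenvalue. Generalized tree shift: for a tree $T$ and distinct vertices $u,w$ such that each internal vertex of the $u$–$w$ path $P$ has degree 2, with $w'$ the neighbour of $w$ on $P$, replace each edge $\{w,z\}$, $z\ne w'$, by $\{u,z\}$. $\mathsf{GTS}_n$: partial order on isomorphism classes of $n$-vertex trees, $T_1\le T_2$ iff $T_2$ arises from $T_1$ by finitely many generalized tree shifts; $T_2$ covers $T_1$ if $T_1\le T_2$, $T_1\ne T_2$, and no tree lies strictly between them. *)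

theory Defs
  imports "Jordan_Normal_Form.Spectral_Radius"
begin

section \<open>Labelled trees\<close>

text \<open>A graph on the vertex set \<open>{..<n}\<close> is given by its set of edges, each edge being a
  two-element set of vertices.\<close>

type_synonym edges = "nat set set"

definition sgraph :: "nat \<Rightarrow> edges \<Rightarrow> bool" where
  "sgraph n E \<longleftrightarrow> (\<forall>e\<in>E. e \<subseteq> {..<n} \<and> card e = 2)"

definition is_path :: "edges \<Rightarrow> nat list \<Rightarrow> bool" where
  "is_path E p \<longleftrightarrow> p \<noteq> [] \<and> distinct p \<and> successively (\<lambda>x y. {x, y} \<in> E) p"

definition path_between :: "edges \<Rightarrow> nat \<Rightarrow> nat list \<Rightarrow> nat \<Rightarrow> bool" where
  "path_between E u p w \<longleftrightarrow> is_path E p \<and> hd p = u \<and> last p = w"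

definition connected_graph :: "nat \<Rightarrow> edges \<Rightarrow> bool" where
  "connected_graph n E \<longleftrightarrow> n > 0 \<and> (\<forall>u<n. \<forall>w<n. \<exists>p. path_between E u p w)"

definition is_cycle :: "edges \<Rightarrow> nat list \<Rightarrow> bool" where
  "is_cycle E p \<longleftrightarrow> length p \<ge> 3 \<and> is_path E p \<and> {last p, hd p} \<in> E"

definition is_tree :: "nat \<Rightarrow> edges \<Rightarrow> bool" where
  "is_tree n E \<longleftrightarrow> sgraph n E \<and> connected_graph n E \<and> (\<nexists>p. is_cycle E p)"

definition vdeg :: "edges \<Rightarrow> nat \<Rightarrow> nat" where
  "vdeg E v = card {e \<in> E. v \<in> e}"


section \<open>The \<open>q\<close>-Laplacian\<close>

definition adj_matrix :: "nat \<Rightarrow> edges \<Rightarrow> real mat" where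
  "adj_matrix n E = mat n n (\<lambda>(i, j). if {i, j} \<in> E then 1 else 0)"

definition deg_matrix :: "nat \<Rightarrow> edges \<Rightarrow> real mat" where
  "deg_matrix n E = mat n n (\<lambda>(i, j). if i = j then real (vdeg E i) else 0)"

definition q_laplacian :: "nat \<Rightarrow> edges \<Rightarrow> real \<Rightarrow> real mat" where
  "q_laplacian n E q =
     1\<^sub>m n + q^2 \<cdot>\<^sub>m (deg_matrix n E - 1\<^sub>m n) - q \<cdot>\<^sub>m adj_matrix n E"

text \<open>\<open>Min\<close> is only meaningful on finite nonempty sets; the spectrum of a real symmetric
  \<open>n \<times> n\<close> matrix with \<open>n > 0\<close> is one.\<close>

definition lambda_min :: "real mat \<Rightarrow> real" where
  "lambda_min M = Min (spectrum M)"


section \<open>Generalized tree shifts\<close>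

text \<open>In a tree the path \<open>p\<close> from \<open>u\<close> to \<open>w\<close> is unique, so quantifying over it existentially
  is harmless. The neighbour of \<open>w\<close> on it is the last but one entry of \<open>p\<close>.\<close>

definition gts_step :: "nat \<Rightarrow> edges \<Rightarrow> edges \<Rightarrow> bool" where
  "gts_step n S T \<longleftrightarrow> is_tree n S \<and>
     (\<exists>u w p. u < n \<and> w < n \<and> u \<noteq> w \<and> path_between S u p w \<and>
        (\<forall>v \<in> set p - {u, w}. vdeg S v = 2) \<and>
        (let w' = last (butlast p); Z = {z. {w, z} \<in> S \<and> z \<noteq> w'}
         in T = (S - {{w, z} | z. z \<in> Z}) \<union> {{u, z} | z. z \<in> Z}))"


section \<open>The poset of isomorphism classes\<close>

definition tree_iso :: "nat \<Rightarrow> (edges \<times> edges) set" where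
  "tree_iso n = {(S, T). is_tree n S \<and> is_tree n T \<and>
     (\<exists>f. bij_betw f {..<n} {..<n} \<and> T = (\<lambda>e. f ` e) ` S)}"

definition GTS :: "nat \<Rightarrow> edges set set" where
  "GTS n = {T. is_tree n T} // tree_iso n"

definition iso_class :: "nat \<Rightarrow> edges \<Rightarrow> edges set" where
  "iso_class n T = tree_iso n `` {T}"

text \<open>A shift of a labelled tree commutes with relabelling, so shifts between the
  representatives suffice.\<close>

definition gts_le :: "nat \<Rightarrow> edges set \<Rightarrow> edges set \<Rightarrow> bool" where
  "gts_le n C D \<longleftrightarrow> C \<in> GTS n \<and> D \<in> GTS n \<and> (\<exists>S\<in>C. \<exists>T\<in>D. (gts_step n)\<^sup>*\<^sup>* S T)"

text \<open>\<open>gts_covers n D C\<close>: the class \<open>D\<close> covers the class \<open>C\<close>.\<close>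

definition gts_covers :: "nat \<Rightarrow> edges set \<Rightarrow> edges set \<Rightarrow> bool" where
  "gts_covers n D C \<longleftrightarrow> gts_le n C D \<and> C \<noteq> D \<and>
     \<not> (\<exists>X \<in> GTS n. X \<noteq> C \<and> X \<noteq> D \<and> gts_le n C X \<and> gts_le n X D)"

lemma equiv_tree_iso: "equiv {T. is_tree n T} (tree_iso n)"
proof (rule equivI)
  show "tree_iso n \<subseteq> {T. is_tree n T} \<times> {T. is_tree n T}"
    by (auto simp: tree_iso_def)
  show "refl_on {T. is_tree n T} (tree_iso n)"
    by (auto simp: refl_on_def tree_iso_def intro!: exI[of _ id])
  show "sym (tree_iso n)"
  proof (rule symI)
    fix S T assume "(S, T) \<in> tree_iso n"
    then obtain f where S: "is_tree n S" and T: "is_tree n T"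
      and f: "bij_betw f {..<n} {..<n}" and TS: "T = (\<lambda>e. f ` e) ` S"
      by (auto simp: tree_iso_def)
    let ?g = "inv_into {..<n} f"
    have "?g ` f ` e = e" if "e \<in> S" for e
    proof -
      have "e \<subseteq> {..<n}" using S that by (auto simp: is_tree_def sgraph_def)
      then show ?thesis using f by (simp add: bij_betw_def inv_into_image_cancel)
    qed
    then have "S = (\<lambda>e. ?g ` e) ` T"
      unfolding TS image_image by simp
    then show "(T, S) \<in> tree_iso n"
      using S T bij_betw_inv_into[OF f] unfolding tree_iso_def by blast
  qed
  show "trans (tree_iso n)"
  proof (rule transI)
    fix S T U assume "(S, T) \<in> tree_iso n" "(T, U) \<in> tree_iso n"
    then obtain f g where *: "is_tree n S" "is_tree n U"
      "bij_betw f {..<n} {..<n}" "bij_betw g {..<n} {..<n}"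
      "T = (\<lambda>e. f ` e) ` S" "U = (\<lambda>e. g ` e) ` T"
      by (auto simp: tree_iso_def)
    then have "U = (\<lambda>e. (g \<circ> f) ` e) ` S" by (simp add: image_image image_comp)
    then show "(S, U) \<in> tree_iso n"
      using * bij_betw_trans[OF *(3,4)] unfolding tree_iso_def by blast
  qed
qed

end

theory Submission
  imports Defs "HOL-Analysis.Function_Topology"
begin

text \<open>Rooted at \<open>r\<close>, the quadratic form of the \<open>q\<close>-Laplacian of a tree is
  \<open>(1 - q\<^sup>2) x\<^sub>r\<^sup>2 + \<Sum> (x\<^sub>c - q x\<^sub>p)\<^sup>2\<close>, summed over the pairs of a child \<open>c\<close> and its parent \<open>p\<close>.
  For \<open>\<bar>q\<bar> \<ge> 1\<close> the least eigenvalue \<open>\<lambda>\<close> is therefore at most \<open>0\<close>: take \<open>x\<^sub>c = q x\<^sub>p\<close> throughout.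
  For a shift along the path \<open>p\<close> from \<open>u\<close> to \<open>w\<close>, let \<open>A\<close> and \<open>B\<close> be the vertices hanging off the
  path at \<open>u\<close> and \<open>w\<close>, and let \<open>x\<close> be an eigenvector for \<open>\<lambda>\<close> of the original tree.
  If \<open>\<bar>x\<^sub>u\<bar> \<le> \<bar>x\<^sub>w\<bar>\<close>, scale \<open>x\<close> on \<open>B\<close> by \<open>t = x\<^sub>u / x\<^sub>w\<close>, so that \<open>B\<close> can be attached at \<open>u\<close>. Otherwise
  reverse \<open>x\<close> along the path and scale it on \<open>A\<close> by \<open>t = x\<^sub>w / x\<^sub>u\<close>. In both cases the contribution
  of the scaled branch to the form minus \<open>\<lambda>\<close> times the squared norm is nonnegative, since
  \<open>\<lambda> \<le> 0\<close>, and it is multiplied by \<open>t\<^sup>2 \<le> 1\<close>. The new vector thus has Rayleigh quotient at most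
  \<open>\<lambda>\<close> on the shifted tree.\<close>

section \<open>The least eigenvalue of a real symmetric matrix\<close>

text \<open>Vectors are functions on all naturals of which only the values below \<open>n\<close>
  count. The product topology on functions then supplies compactness.\<close>

definition bilin :: "(nat \<Rightarrow> nat \<Rightarrow> real) \<Rightarrow> nat \<Rightarrow> (nat \<Rightarrow> real) \<Rightarrow> (nat \<Rightarrow> real) \<Rightarrow> real" where
  "bilin a n x y = (\<Sum>i<n. \<Sum>j<n. a i j * x i * y j)"

definition sq_norm :: "nat \<Rightarrow> (nat \<Rightarrow> real) \<Rightarrow> real" where
  "sq_norm n x = (\<Sum>i<n. (x i)\<^sup>2)"

lemma sq_norm_nonneg: "0 \<le> sq_norm n x"
  by (simp add: sq_norm_def sum_nonneg)

lemma sq_norm_pos_iff: "0 < sq_norm n x \<longleftrightarrow> (\<exists>i<n. x i \<noteq> 0)"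
  using sq_norm_nonneg[of n x] sum_nonneg_eq_0_iff[of "{..<n}" "\<lambda>i. (x i)\<^sup>2"]
  by (auto simp: sq_norm_def order.strict_iff_order)

lemma bilin_eq_sum: "bilin a n x y = (\<Sum>i<n. x i * (\<Sum>j<n. a i j * y j))"
  by (simp add: bilin_def sum_distrib_left mult_ac)

lemma bilin_commute:
  assumes "\<And>i j. i < n \<Longrightarrow> j < n \<Longrightarrow> a i j = a j i"
  shows "bilin a n x y = bilin a n y x"
  unfolding bilin_def by (subst sum.swap) (auto intro!: sum.cong simp: assms)

lemma bilin_add_scale:
  assumes "\<And>i j. i < n \<Longrightarrow> j < n \<Longrightarrow> a i j = a j i"
  shows "bilin a n (\<lambda>i. x i + t * y i) (\<lambda>i. x i + t * y i) =
    bilin a n x x + 2 * t * bilin a n y x + t\<^sup>2 * bilin a n y y"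
proof -
  have "bilin a n (\<lambda>i. x i + t * y i) (\<lambda>i. x i + t * y i) =
    bilin a n x x + t * bilin a n y x + t * bilin a n x y + t\<^sup>2 * bilin a n y y"
    unfolding bilin_def
    by (simp add: algebra_simps sum.distrib sum_distrib_left power2_eq_square)
  then show ?thesis
    using bilin_commute[of n a x y] assms by simp
qed

lemma sq_norm_add_scale:
  "sq_norm n (\<lambda>i. x i + t * y i) = sq_norm n x + 2 * t * (\<Sum>i<n. y i * x i) + t\<^sup>2 * sq_norm n y"
  unfolding sq_norm_def
  by (simp add: algebra_simps sum.distrib sum_distrib_left power2_eq_square)

text \<open>First-order condition at a minimum: the quadratic vanishes at \<open>t = 0\<close> and
  is nonnegative, so its derivative there is zero.\<close>

lemma linear_coeff_zero:
  fixes r c :: real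
  assumes "\<And>t. 0 \<le> 2 * t * r + t\<^sup>2 * c"
  shows "r = 0"
proof (rule ccontr)
  assume r: "r \<noteq> 0"
  \<comment> \<open>With \<open>t = - r / d\<close> the quadratic equals
    \<open>r^2 / d^2 * (c - 2 * d)\<close>, and this \<open>d\<close> is positive and exceeds
    \<open>c / 2\<close>.\<close>
  define d where "d = \<bar>c\<bar> + 1"
  have d: "d > 0" by (simp add: d_def)
  have "0 \<le> 2 * (- r / d) * r + (- r / d)\<^sup>2 * c" by (rule assms)
  also have "\<dots> = r\<^sup>2 / d\<^sup>2 * (c - 2 * d)"
    using d by (simp add: field_simps power2_eq_square)
  finally have "0 \<le> r\<^sup>2 / d\<^sup>2 * (c - 2 * d)" .
  moreover have "0 < r\<^sup>2 / d\<^sup>2" using r d by simp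
  ultimately have "0 \<le> c - 2 * d" by (metis zero_le_mult_iff not_le)
  then show False using d_def by linarith
qed

text \<open>Pinning the coordinates from \<open>n\<close> on to 0 makes the sphere a closed subset
  of a product of compact intervals and points, so Tychonoff applies.\<close>

lemma compact_unit_sphere:
  "compact {x. (\<forall>i\<ge>n. x i = 0) \<and> sq_norm n x = 1}" (is "compact ?S")
proof -
  let ?B = "\<lambda>i::nat. if i < n then {-1..1} else {0::real}"
  have "compactin (product_topology (\<lambda>i::nat. euclidean) UNIV) (PiE UNIV ?B)"
    by (subst compactin_PiE) (auto simp: compactin_euclidean_iff)
  then have cB: "compact (PiE UNIV ?B)"
    by (simp add: euclidean_product_topology compactin_euclidean_iff)
  have "closed {x::nat \<Rightarrow> real. sq_norm n x = 1}"
    unfolding sq_norm_def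
    by (intro closed_Collect_eq continuous_intros continuous_on_product_coordinates)
  then have "compact (PiE UNIV ?B \<inter> {x. sq_norm n x = 1})"
    using cB by (rule compact_Int_closed[rotated])
  moreover have "PiE UNIV ?B \<inter> {x. sq_norm n x = 1} = ?S"
  proof -
    have "x i \<in> {-1..1}" if "sq_norm n x = 1" "i < n" for x i
    proof -
      have "(x i)\<^sup>2 \<le> sq_norm n x"
        unfolding sq_norm_def using that(2) by (intro member_le_sum) auto
      then have "\<bar>x i\<bar> \<le> 1" using that(1) by (simp add: abs_square_le_1)
      then show ?thesis by auto
    qed
    moreover have "x \<in> PiE UNIV ?B \<longleftrightarrow> (\<forall>i\<ge>n. x i = 0) \<and> (\<forall>i<n. x i \<in> {-1..1})" for x
      by (simp add: PiE_UNIV_domain Pi_iff) (metis not_le)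
    ultimately show ?thesis by blast
  qed
  ultimately show ?thesis by simp
qed

text \<open>The form attains its minimum \<mu> on the unit sphere. Homogeneity extends the bound to
  all vectors, and stationarity makes the minimiser an eigenvector.\<close>

lemma symmetric_least_eigenvalue:
  fixes a :: "nat \<Rightarrow> nat \<Rightarrow> real"
  assumes n: "n > 0" and sym: "\<And>i j. i < n \<Longrightarrow> j < n \<Longrightarrow> a i j = a j i"
  obtains \<mu> x where "\<exists>i<n. x i \<noteq> 0" and "\<And>i. i < n \<Longrightarrow> (\<Sum>j<n. a i j * x j) = \<mu> * x i"
    and "\<And>y. \<mu> * sq_norm n y \<le> bilin a n y y"
proof -
  let ?S = "{x. (\<forall>i\<ge>n. x i = 0) \<and> sq_norm n x = 1}"
  have "sq_norm n (\<lambda>i. if i = 0 then 1 else 0) = (\<Sum>i<n. if i = 0 then 1 else 0)"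
    unfolding sq_norm_def by (intro sum.cong) auto
  then have "(\<lambda>i. if i = 0 then 1 else 0) \<in> ?S" using n by simp
  then have ne: "?S \<noteq> {}" by (metis equals0D)
  have "continuous_on UNIV (\<lambda>x. bilin a n x x)"
    unfolding bilin_def
    by (intro continuous_intros continuous_on_product_coordinates)
  then have "continuous_on ?S (\<lambda>x. bilin a n x x)" by (rule continuous_on_subset) simp
  from continuous_attains_inf[OF compact_unit_sphere ne this]
  obtain x where x: "sq_norm n x = 1" and x0: "\<And>i. i \<ge> n \<Longrightarrow> x i = 0"
    and min: "\<And>y. y \<in> ?S \<Longrightarrow> bilin a n x x \<le> bilin a n y y" by blast
  define \<mu> where "\<mu> = bilin a n x x"
  have bound: "\<mu> * sq_norm n y \<le> bilin a n y y" for y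
  proof (cases "sq_norm n y = 0")
    case True
    then have "y i = 0" if "i < n" for i
      using sq_norm_pos_iff[of n y] that by auto
    then show ?thesis by (simp add: bilin_def sq_norm_def)
  next
    case False
    then have pos: "sq_norm n y > 0" using sq_norm_nonneg[of n y] by linarith
    define s where "s = sqrt (sq_norm n y)"
    have s: "s\<^sup>2 = sq_norm n y" "s \<noteq> 0" using pos by (auto simp: s_def)
    \<comment> \<open>Normalising is not enough for \<open>z \<in> ?S\<close>: the coordinates from
      \<open>n\<close> on must also be cut off.\<close>
    define z where "z i = (if i < n then y i / s else 0)" for i
    have "sq_norm n z = sq_norm n y / s\<^sup>2"
      by (simp add: sq_norm_def z_def power_divide sum_divide_distrib)
    then have "z \<in> ?S" using s pos by (auto simp: z_def)
    then have "\<mu> \<le> bilin a n z z" unfolding \<mu>_def by (rule min)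
    also have "bilin a n z z = bilin a n y y / s\<^sup>2"
      by (simp add: bilin_def z_def sum_divide_distrib power2_eq_square)
    finally show ?thesis using s(1) pos by (simp add: field_simps)
  qed
  have eig: "(\<Sum>j<n. a i j * x j) = \<mu> * x i" if i: "i < n" for i
  proof -
    define e where "e j = (if j = i then 1 else 0::real)" for j
    have e: "bilin a n e x = (\<Sum>j<n. a i j * x j)" "(\<Sum>j<n. e j * x j) = x i"
      using i by (simp_all add: bilin_eq_sum e_def if_distrib[of "\<lambda>x. x * _"] cong: if_cong)
    \<comment> \<open>The form minus \<mu> times the squared norm is nonnegative and vanishes at
      \<open>x\<close>. Along \<open>x + t e\<close> it is a quadratic in \<open>t\<close> without
      constant term, with twice the \<open>i\<close>-th residual of the eigenvalue equation as
      linear coefficient.\<close>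
    have "0 \<le> 2 * t * ((\<Sum>j<n. a i j * x j) - \<mu> * x i) + t\<^sup>2 * (bilin a n e e - \<mu> * sq_norm n e)" for t
    proof -
      have "bilin a n (\<lambda>i. x i + t * e i) (\<lambda>i. x i + t * e i) =
          \<mu> + 2 * t * bilin a n e x + t\<^sup>2 * bilin a n e e"
        unfolding \<mu>_def by (rule bilin_add_scale) (rule sym)
      then show ?thesis
        using bound[of "\<lambda>i. x i + t * e i"] x
        unfolding sq_norm_add_scale e by (simp add: algebra_simps)
    qed
    from linear_coeff_zero[OF this] show ?thesis by simp
  qed
  show ?thesis
    using that[of x \<mu>] eig bound x sq_norm_pos_iff[of n x] by auto
qed

section \<open>Variational characterisation of \<open>lambda_min\<close>\<close>

lemma mat_mult_vec_eq_scale_iff: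
  assumes "A \<in> carrier_mat n n"
  shows "A *\<^sub>v vec n x = k \<cdot>\<^sub>v vec n x \<longleftrightarrow> (\<forall>i<n. (\<Sum>j<n. A $$ (i, j) * x j) = k * x i)"
  using assms by (auto simp: vec_eq_iff scalar_prod_def atLeast0LessThan)

lemma eigenvalue_iff:
  assumes "A \<in> carrier_mat n n"
  shows "eigenvalue A k \<longleftrightarrow>
    (\<exists>x. (\<exists>i<n. x i \<noteq> 0) \<and> (\<forall>i<n. (\<Sum>j<n. A $$ (i, j) * x j) = k * x i))"
    (is "_ \<longleftrightarrow> ?R")
proof
  assume "eigenvalue A k"
  then obtain v where "v \<in> carrier_vec n" "v \<noteq> 0\<^sub>v n" "A *\<^sub>v v = k \<cdot>\<^sub>v v"
    using assms by (auto simp: eigenvalue_def eigenvector_def)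
  moreover from this have "vec n (\<lambda>i. v $ i) = v" "\<exists>i<n. v $ i \<noteq> 0"
    by (auto simp: vec_eq_iff)
  ultimately show ?R using mat_mult_vec_eq_scale_iff[OF assms, of "\<lambda>i. v $ i" k] by metis
next
  assume ?R
  then obtain x where "\<exists>i<n. x i \<noteq> 0" "A *\<^sub>v vec n x = k \<cdot>\<^sub>v vec n x"
    using mat_mult_vec_eq_scale_iff[OF assms] by blast
  then show "eigenvalue A k" using assms
    unfolding eigenvalue_def eigenvector_def by (intro exI[of _ "vec n x"]) (auto simp: vec_eq_iff)
qed

text \<open>Every eigenvalue is the Rayleigh quotient of its eigenvector, hence at least \<mu>; so
  \<mu> is the minimum of the spectrum. The first claim yields an optimal vector on one tree, the
  second admits test vectors on another.\<close>

lemma lambda_min_variational: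
  assumes A: "A \<in> carrier_mat n n" and n: "n > 0"
    and sym: "\<And>i j. i < n \<Longrightarrow> j < n \<Longrightarrow> A $$ (i, j) = A $$ (j, i)"
  defines "a \<equiv> \<lambda>i j. A $$ (i, j)"
  shows "\<exists>x. (\<exists>i<n. x i \<noteq> 0) \<and> bilin a n x x = lambda_min A * sq_norm n x"
    and "lambda_min A * sq_norm n y \<le> bilin a n y y"
proof -
  have rayleigh: "bilin a n x x = k * sq_norm n x"
    if "\<forall>i<n. (\<Sum>j<n. A $$ (i, j) * x j) = k * x i" for x k
  proof -
    have "bilin a n x x = (\<Sum>i<n. x i * (k * x i))"
      unfolding bilin_eq_sum a_def using that by (intro sum.cong) auto
    also have "\<dots> = k * sq_norm n x"
      unfolding sq_norm_def sum_distrib_left by (simp add: power2_eq_square mult_ac)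
    finally show ?thesis .
  qed
  obtain \<mu> x where x: "\<exists>i<n. x i \<noteq> 0" "\<And>i. i < n \<Longrightarrow> (\<Sum>j<n. a i j * x j) = \<mu> * x i"
    and bound: "\<And>y. \<mu> * sq_norm n y \<le> bilin a n y y"
    by (rule symmetric_least_eigenvalue[of n a]) (use n sym in \<open>auto simp: a_def\<close>)
  have "lambda_min A = \<mu>"
    unfolding lambda_min_def
  proof (rule Min_eqI)
    show "finite (spectrum A)" using A by (rule card_finite_spectrum)
    show "\<mu> \<in> spectrum A" using x eigenvalue_iff[OF A] by (auto simp: spectrum_def a_def)
    fix k assume "k \<in> spectrum A"
    then obtain y where y: "\<exists>i<n. y i \<noteq> 0" "\<forall>i<n. (\<Sum>j<n. A $$ (i, j) * y j) = k * y i"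
      using eigenvalue_iff[OF A] by (auto simp: spectrum_def)
    have "\<mu> * sq_norm n y \<le> k * sq_norm n y" using bound[of y] rayleigh[OF y(2)] by simp
    then show "\<mu> \<le> k" using y(1) sq_norm_pos_iff[of n y] by simp
  qed
  moreover have "bilin a n x x = \<mu> * sq_norm n x" using x(2) by (intro rayleigh) (auto simp: a_def)
  ultimately show "\<exists>x. (\<exists>i<n. x i \<noteq> 0) \<and> bilin a n x x = lambda_min A * sq_norm n x"
    and "lambda_min A * sq_norm n y \<le> bilin a n y y"
    using x(1) bound by auto
qed

section \<open>The quadratic form of the q-Laplacian\<close>

text \<open>Summing and multiplying over the edge as a set avoids choosing an orientation and turns
  relabelling into reindexing.\<close>

definition edge_form :: "real \<Rightarrow> (nat \<Rightarrow> real) \<Rightarrow> nat set \<Rightarrow> real" where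
  "edge_form q x e = q\<^sup>2 * (\<Sum>v\<in>e. (x v)\<^sup>2) - 2 * q * (\<Prod>v\<in>e. x v)"

text \<open>The term q^2 D is distributed over the edges: each edge gives q^2 x_v^2 to both of its
  ends.\<close>

definition qform :: "real \<Rightarrow> nat \<Rightarrow> edges \<Rightarrow> (nat \<Rightarrow> real) \<Rightarrow> real" where
  "qform q n E x = (1 - q\<^sup>2) * sq_norm n x + (\<Sum>e\<in>E. edge_form q x e)"

lemma edge_form_doubleton:
  "a \<noteq> b \<Longrightarrow> edge_form q x {a, b} = q\<^sup>2 * ((x a)\<^sup>2 + (x b)\<^sup>2) - 2 * q * (x a * x b)"
  by (simp add: edge_form_def)

lemma edge_form_scale: "card e = 2 \<Longrightarrow> edge_form q (\<lambda>v. t * x v) e = t\<^sup>2 * edge_form q x e"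
  by (auto simp: card_2_iff edge_form_doubleton power_mult_distrib algebra_simps power2_eq_square)

lemma edge_form_image: "inj_on f e \<Longrightarrow> edge_form q x (f ` e) = edge_form q (x \<circ> f) e"
  by (simp add: edge_form_def sum.reindex prod.reindex)

lemma edge_form_cong: "(\<And>v. v \<in> e \<Longrightarrow> x v = y v) \<Longrightarrow> edge_form q x e = edge_form q y e"
  by (simp add: edge_form_def cong: sum.cong prod.cong)

text \<open>Moving edges along an injective vertex map amounts to pulling the vector back. This
  serves the reversal of the path, the reattachment of a branch, and isomorphisms.\<close>

lemma sum_edge_form_image:
  assumes "inj_on f (\<Union>F)"
  shows "(\<Sum>e\<in>(`) f ` F. edge_form q x e) = (\<Sum>e\<in>F. edge_form q (x \<circ> f) e)"
proof -
  have "inj_on ((`) f) F"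
    using inj_on_image[OF assms] .
  then have "(\<Sum>e\<in>(`) f ` F. edge_form q x e) = (\<Sum>e\<in>F. edge_form q x (f ` e))"
    by (simp add: sum.reindex)
  also have "\<dots> = (\<Sum>e\<in>F. edge_form q (x \<circ> f) e)"
    using assms by (intro sum.cong edge_form_image) (auto intro: inj_on_subset)
  finally show ?thesis .
qed

section \<open>Identification of the edge form with the matrix form\<close>

lemma sgraph_finite: "sgraph n E \<Longrightarrow> finite E"
  by (rule finite_subset[of _ "Pow {..<n}"]) (auto simp: sgraph_def)

lemma q_laplacian_carrier: "q_laplacian n E q \<in> carrier_mat n n"
  by (rule carrier_matI) (simp_all add: q_laplacian_def adj_matrix_def)

lemma q_laplacian_index:
  "i < n \<Longrightarrow> j < n \<Longrightarrow> q_laplacian n E q $$ (i, j) =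
    (if i = j then 1 - q\<^sup>2 + q\<^sup>2 * real (vdeg E i) else 0) - q * (if {i, j} \<in> E then 1 else 0)"
  by (simp add: q_laplacian_def adj_matrix_def deg_matrix_def algebra_simps)

text \<open>Double counting of incident pairs of a vertex and an edge.\<close>

lemma sum_vdeg:
  assumes "sgraph n E"
  shows "(\<Sum>i<n. real (vdeg E i) * f i) = (\<Sum>e\<in>E. \<Sum>v\<in>e. f v)"
proof -
  have fin: "finite E" using assms by (rule sgraph_finite)
  have "(\<Sum>i<n. real (vdeg E i) * f i) = (\<Sum>i<n. \<Sum>e\<in>E. if i \<in> e then f i else 0)"
    by (simp add: vdeg_def sum.If_cases[OF fin] Int_def)
  also have "\<dots> = (\<Sum>e\<in>E. \<Sum>i<n. if i \<in> e then f i else 0)" by (rule sum.swap)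
  also have "\<dots> = (\<Sum>e\<in>E. \<Sum>v\<in>e. f v)"
  proof (rule sum.cong[OF refl])
    fix e assume "e \<in> E"
    then have "{..<n} \<inter> e = e" using assms by (auto simp: sgraph_def)
    then show "(\<Sum>i<n. if i \<in> e then f i else 0) = (\<Sum>v\<in>e. f v)"
      using sum.inter_restrict[of "{..<n}" f e] by simp
  qed
  finally show ?thesis .
qed

lemma sum_adjacency:
  fixes x :: "nat \<Rightarrow> real"
  assumes "sgraph n E"
  shows "(\<Sum>i<n. \<Sum>j<n. if {i, j} \<in> E then x i * x j else 0) = 2 * (\<Sum>e\<in>E. \<Prod>v\<in>e. x v)"
proof -
  have fin: "finite E" using assms by (rule sgraph_finite)
  have "(\<Sum>i<n. \<Sum>j<n. if {i, j} \<in> E then x i * x j else 0)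
      = (\<Sum>i<n. \<Sum>j<n. \<Sum>e\<in>E. if {i, j} = e then x i * x j else 0)"
    using fin by simp
  also have "\<dots> = (\<Sum>i<n. \<Sum>e\<in>E. \<Sum>j<n. if {i, j} = e then x i * x j else 0)"
    by (intro sum.cong refl sum.swap)
  also have "\<dots> = (\<Sum>e\<in>E. \<Sum>i<n. \<Sum>j<n. if {i, j} = e then x i * x j else 0)"
    by (rule sum.swap)
  also have "\<dots> = (\<Sum>e\<in>E. 2 * (\<Prod>v\<in>e. x v))"
  proof (rule sum.cong[OF refl])
    fix e assume "e \<in> E"
    then obtain a b where ab: "e = {a, b}" "a \<noteq> b" "a < n" "b < n"
      using assms by (auto simp: sgraph_def card_2_iff)
    \<comment> \<open>Exactly the two ordered pairs \<open>(a, b)\<close> and \<open>(b, a)\<close>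
      produce the edge, whence the factor 2.\<close>
    have "(\<Sum>i<n. \<Sum>j<n. if {i, j} = e then x i * x j else 0)
        = (\<Sum>i<n. \<Sum>j<n. (if i = a then if j = b then x a * x b else 0 else 0)
            + (if i = b then if j = a then x b * x a else 0 else 0))"
      using ab by (intro sum.cong refl) (auto simp: doubleton_eq_iff)
    also have "\<dots> = (\<Sum>i<n. if i = a then x a * x b else 0) + (\<Sum>i<n. if i = b then x b * x a else 0)"
      unfolding sum.distrib
      by (intro arg_cong2[of _ _ _ _ "(+)"] sum.cong refl) (use ab in auto)
    finally show "(\<Sum>i<n. \<Sum>j<n. if {i, j} = e then x i * x j else 0) = 2 * (\<Prod>v\<in>e. x v)"
      using ab by simp
  qed
  finally show ?thesis by (simp add: sum_distrib_left)
qed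

lemma bilin_q_laplacian:
  assumes "sgraph n E"
  shows "bilin (\<lambda>i j. q_laplacian n E q $$ (i, j)) n x x = qform q n E x"
proof -
  have "bilin (\<lambda>i j. q_laplacian n E q $$ (i, j)) n x x =
      (\<Sum>i<n. \<Sum>j<n. (if i = j then (1 - q\<^sup>2) * (x i)\<^sup>2 + q\<^sup>2 * (real (vdeg E i) * (x i)\<^sup>2) else 0)
        - q * (if {i, j} \<in> E then x i * x j else 0))"
    unfolding bilin_def
    by (intro sum.cong refl) (auto simp: q_laplacian_index algebra_simps power2_eq_square)
  also have "\<dots> = (1 - q\<^sup>2) * sq_norm n x + q\<^sup>2 * (\<Sum>i<n. real (vdeg E i) * (x i)\<^sup>2)
      - q * (\<Sum>i<n. \<Sum>j<n. if {i, j} \<in> E then x i * x j else 0)"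
    unfolding sq_norm_def sum_subtractf sum_distrib_left by (simp add: sum.distrib)
  also have "\<dots> = qform q n E x"
    unfolding sum_vdeg[OF assms] sum_adjacency[OF assms] qform_def edge_form_def
    by (simp add: sum_subtractf sum_distrib_left mult_ac)
  finally show ?thesis .
qed

lemma q_laplacian_symmetric:
  "i < n \<Longrightarrow> j < n \<Longrightarrow> q_laplacian n E q $$ (i, j) = q_laplacian n E q $$ (j, i)"
  by (simp add: q_laplacian_index insert_commute)

lemma lambda_min_attained:
  assumes "n > 0" "sgraph n E"
  obtains x where "\<exists>i<n. x i \<noteq> 0" "qform q n E x = lambda_min (q_laplacian n E q) * sq_norm n x"
  using lambda_min_variational(1)[OF q_laplacian_carrier assms(1) q_laplacian_symmetric, of E q]
  unfolding bilin_q_laplacian[OF assms(2)] by blast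

lemma lambda_min_le:
  assumes "sgraph n E" and x: "\<exists>i<n. x i \<noteq> 0" and le: "qform q n E x \<le> c * sq_norm n x"
  shows "lambda_min (q_laplacian n E q) \<le> c"
proof -
  have "n > 0" using x by auto
  then have "lambda_min (q_laplacian n E q) * sq_norm n x \<le> qform q n E x"
    using lambda_min_variational(2)[OF q_laplacian_carrier _ q_laplacian_symmetric, of n E q x]
    unfolding bilin_q_laplacian[OF assms(1)] by blast
  then have "lambda_min (q_laplacian n E q) * sq_norm n x \<le> c * sq_norm n x" using le by simp
  then show ?thesis using x sq_norm_pos_iff[of n x] by simp
qed

section \<open>Rooted trees\<close>

text \<open>A tree on \<open>insert r B\<close> built by adding leaves. The root is left out of
  \<open>B\<close>, so that its own norm term is counted elsewhere, with the path or
  separately.\<close>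

inductive hang :: "nat \<Rightarrow> nat set \<Rightarrow> edges \<Rightarrow> bool" for r where
  empty: "hang r {} {}"
| leaf: "hang r B F \<Longrightarrow> v \<notin> B \<Longrightarrow> v \<noteq> r \<Longrightarrow> a \<in> insert r B \<Longrightarrow> hang r (insert v B) (insert {v, a} F)"

definition hang_form :: "real \<Rightarrow> nat set \<Rightarrow> edges \<Rightarrow> (nat \<Rightarrow> real) \<Rightarrow> real" where
  "hang_form q B F x = (1 - q\<^sup>2) * (\<Sum>v\<in>B. (x v)\<^sup>2) + (\<Sum>e\<in>F. edge_form q x e)"

lemma hang_finite: "hang r B F \<Longrightarrow> finite B \<and> finite F"
  by (induction rule: hang.induct) auto

lemma hang_root: "hang r B F \<Longrightarrow> r \<notin> B"
  by (induction rule: hang.induct) auto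

lemma hang_edge:
  "hang r B F \<Longrightarrow> e \<in> F \<Longrightarrow> e \<subseteq> insert r B \<and> card e = 2 \<and> e \<inter> B \<noteq> {}"
  by (induction rule: hang.induct) (auto simp: card_insert_if)

text \<open>The term (1 - q^2) x_v^2 of the new vertex and the q^2 x_v^2 of its edge add up to
  x_v^2, which completes the square. Nonnegativity of \<open>hang_form\<close> follows by
  induction.\<close>

lemma hang_form_leaf:
  assumes "hang r B F" "v \<notin> B" "v \<noteq> r" "a \<in> insert r B"
  shows "hang_form q (insert v B) (insert {v, a} F) x = hang_form q B F x + (x v - q * x a)\<^sup>2"
proof -
  have "{v, a} \<notin> F" using hang_edge[OF assms(1)] assms by blast
  moreover have "v \<noteq> a" using assms by auto
  ultimately show ?thesis
    using hang_finite[OF assms(1)] assms(2) unfolding hang_form_def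
    by (simp add: edge_form_doubleton algebra_simps power2_eq_square)
qed

lemma hang_form_cong:
  assumes "hang r B F" "\<And>v. v \<in> insert r B \<Longrightarrow> x v = y v"
  shows "hang_form q B F x = hang_form q B F y"
proof -
  have "(\<Sum>e\<in>F. edge_form q x e) = (\<Sum>e\<in>F. edge_form q y e)"
    using hang_edge[OF assms(1)] assms(2) by (intro sum.cong edge_form_cong) blast+
  then show ?thesis using assms(2) by (simp add: hang_form_def)
qed

lemma hang_form_scale:
  assumes "hang r B F"
  shows "hang_form q B F (\<lambda>v. t * x v) = t\<^sup>2 * hang_form q B F x"
proof -
  have "(\<Sum>e\<in>F. edge_form q (\<lambda>v. t * x v) e) = t\<^sup>2 * (\<Sum>e\<in>F. edge_form q x e)"
    unfolding sum_distrib_left using hang_edge[OF assms] by (intro sum.cong edge_form_scale) auto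
  then show ?thesis
    by (simp add: hang_form_def power_mult_distrib sum_distrib_left[symmetric] algebra_simps)
qed

lemma hang_form_nonneg: "hang r B F \<Longrightarrow> 0 \<le> hang_form q B F x"
proof (induction rule: hang.induct)
  case empty
  then show ?case by (simp add: hang_form_def)
next
  case (leaf B F v a)
  then show ?case by (simp add: hang_form_leaf)
qed

lemma hang_form_zero: "hang r B F \<Longrightarrow> \<exists>x. x r = 1 \<and> hang_form q B F x = 0"
proof (induction rule: hang.induct)
  case empty
  show ?case by (rule exI[of _ "\<lambda>_. 1"]) (simp add: hang_form_def)
next
  case (leaf B F v a)
  then obtain x where x: "x r = 1" "hang_form q B F x = 0" by blast
  \<comment> \<open>This value kills the square contributed by the new leaf and leaves the earlier
    ones unchanged.\<close>
  let ?x = "x(v := q * x a)"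
  have "hang_form q B F ?x = hang_form q B F x"
    using leaf.hyps by (intro hang_form_cong) auto
  moreover have "?x a = x a" "?x v = q * x a" "?x r = 1" using x leaf.hyps by auto
  ultimately show ?case
    using x leaf.hyps by (intro exI[of _ ?x]) (simp add: hang_form_leaf del: fun_upd_apply)
qed

section \<open>Growing connected vertex sets in a tree\<close>

lemma successively_crossing:
  assumes "successively R p" "p \<noteq> []" "hd p \<in> X" "last p \<notin> X"
  shows "\<exists>a v. a \<in> X \<and> v \<notin> X \<and> R a v"
  using assms
proof (induction p)
  case (Cons y p)
  then show ?case by (cases p) (auto split: if_splits)
qed simp

text \<open>A connected vertex set of a tree can be enlarged one vertex at a time. The new vertex has a
  single neighbour in the old set, since two of them would close a cycle.\<close>

lemma tree_grow:
  assumes tree: "is_tree n E" and X0: "X0 \<subseteq> {..<n}" "X0 \<noteq> {}"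
    and conn: "\<And>a b. a \<in> X0 \<Longrightarrow> b \<in> X0 \<Longrightarrow> \<exists>p. path_between E a p b \<and> set p \<subseteq> X0"
    and base: "P X0"
    and step: "\<And>X v a. \<lbrakk>X0 \<subseteq> X; v \<notin> X; a \<in> X; {v, a} \<in> E;
      \<And>b. b \<in> X \<Longrightarrow> {v, b} \<in> E \<Longrightarrow> b = a; P X\<rbrakk> \<Longrightarrow> P (insert v X)"
  shows "P {..<n}"
proof -
  have sg: "sgraph n E" and cg: "connected_graph n E" and ac: "\<nexists>p. is_cycle E p"
    using tree by (auto simp: is_tree_def)
  \<comment> \<open>The induction, on the number of missing vertices, must carry the connectedness
    of the current set \<open>X\<close> along with \<open>P X\<close>.\<close>
  have "P {..<n}" if "X0 \<subseteq> X" "X \<subseteq> {..<n}" "P X"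
    "\<And>a b. a \<in> X \<Longrightarrow> b \<in> X \<Longrightarrow> \<exists>p. path_between E a p b \<and> set p \<subseteq> X" for X
    using that
  proof (induction "card ({..<n} - X)" arbitrary: X rule: less_induct)
    case less
    note con = less.prems(4)
    show ?case
    proof (cases "X = {..<n}")
      case True
      then show ?thesis using less.prems by simp
    next
      case False
      then obtain c where c: "c < n" "c \<notin> X" using less.prems by auto
      obtain d where d: "d \<in> X" "d < n" using X0 less.prems by auto
      obtain p where "path_between E d p c"
        using cg c d by (auto simp: connected_graph_def)
      then obtain a v where av: "a \<in> X" "v \<notin> X" "{a, v} \<in> E"
        using successively_crossing[of "\<lambda>x y. {x, y} \<in> E" p X] c d
        by (auto simp: path_between_def is_path_def)
      have va: "{v, a} \<in> E" using av by (simp add: insert_commute)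
      have v: "v < n" using av sg by (auto simp: sgraph_def)
      have uniq: "b = a" if b: "b \<in> X" "{v, b} \<in> E" for b
      proof (rule ccontr)
        assume ne: "b \<noteq> a"
        obtain p where p: "path_between E a p b" "set p \<subseteq> X" using con av b by blast
        then obtain x xs where xs: "p = x # xs" by (cases p) (auto simp: path_between_def is_path_def)
        \<comment> \<open>Since \<open>a\<close> and \<open>b\<close> differ, the path has at least
          two vertices, so prefixing \<open>v\<close> gives the length 3 that a cycle
          requires.\<close>
        moreover have "xs \<noteq> []" using p ne xs by (auto simp: path_between_def)
        ultimately have "is_cycle E (v # p)"
          using p va av b by (cases xs) (auto simp: is_cycle_def path_between_def is_path_def insert_commute)
        then show False using ac by blast
      qed
      have "\<exists>p. path_between E x p y \<and> set p \<subseteq> insert v X"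
        if xy: "x \<in> insert v X" "y \<in> insert v X" for x y
      proof -
        consider "x \<in> X" "y \<in> X" | "x = v" "y = v" | "x = v" "y \<in> X" | "x \<in> X" "y = v"
          using xy by blast
        then show ?thesis
        proof cases
          case 1
          then show ?thesis using con by blast
        next
          case 2
          then show ?thesis by (intro exI[of _ "[v]"]) (auto simp: path_between_def is_path_def)
        next
          case 3
          then obtain p where "path_between E a p y" "set p \<subseteq> X" using con av by blast
          then show ?thesis using 3 va av
            by (intro exI[of _ "v # p"]) (auto simp: path_between_def is_path_def successively_Cons)
        next
          case 4
          then obtain p where "path_between E x p a" "set p \<subseteq> X" using con av by blast
          then show ?thesis using 4 av
            by (intro exI[of _ "p @ [v]"])
              (auto simp: path_between_def is_path_def successively_append_iff)
        qed
      qed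
      moreover have "P (insert v X)"
        using less.prems(1) av(2,1) va uniq less.prems(3) by (rule step)
      moreover have "card ({..<n} - insert v X) < card ({..<n} - X)"
        using v av by (intro psubset_card_mono) auto
      ultimately show ?thesis
        using less.hyps[of "insert v X"] less.prems v by auto
    qed
  qed
  from this[OF subset_refl X0(1) base conn] show ?thesis .
qed

text \<open>Translates a growth step of \<open>tree_grow\<close> into the single edge that the rule
  \<open>hang.leaf\<close> adds.\<close>

lemma edges_within_insert:
  assumes "sgraph n E" "v \<notin> X" "a \<in> X" "{v, a} \<in> E" "\<And>b. b \<in> X \<Longrightarrow> {v, b} \<in> E \<Longrightarrow> b = a"
  shows "{e \<in> E. e \<subseteq> insert v X} = insert {v, a} {e \<in> E. e \<subseteq> X}"
proof -
  have "e = {v, a}" if e: "e \<in> E" "e \<subseteq> insert v X" "\<not> e \<subseteq> X" for e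
  proof -
    have "v \<in> e" "card e = 2" using e assms(1) by (auto simp: sgraph_def)
    then obtain b where "e = {v, b}" "b \<noteq> v" by (auto simp: card_2_iff)
    then show ?thesis using e assms(5) by auto
  qed
  then show ?thesis using assms(3,4) by blast
qed

text \<open>Growing from the single vertex \<open>r\<close>, each step of \<open>tree_grow\<close>
  is one application of \<open>hang.leaf\<close>.\<close>

lemma tree_hang:
  assumes tree: "is_tree n E" and r: "r < n"
  shows "hang r ({..<n} - {r}) E"
proof -
  have sg: "sgraph n E" using tree by (simp add: is_tree_def)
  have "hang r ({..<n} - {r}) {e \<in> E. e \<subseteq> {..<n}}"
  proof (rule tree_grow[OF tree, where ?X0.0 = "{r}"])
    show "\<exists>p. path_between E a p b \<and> set p \<subseteq> {r}" if "a \<in> {r}" "b \<in> {r}" for a b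
      using that by (intro exI[of _ "[r]"]) (auto simp: path_between_def is_path_def)
    have "\<not> e \<subseteq> {r}" if "e \<in> E" for e
      using that sg card_mono[of "{r}" e] by (auto simp: sgraph_def)
    then have no_edge: "{e \<in> E. e \<subseteq> {r}} = {}" by blast
    show "hang r ({r} - {r}) {e \<in> E. e \<subseteq> {r}}"
      unfolding no_edge Diff_cancel by (rule hang.empty)
  next
    fix X v a
    assume *: "{r} \<subseteq> X" "v \<notin> X" "a \<in> X" "{v, a} \<in> E" "\<And>b. b \<in> X \<Longrightarrow> {v, b} \<in> E \<Longrightarrow> b = a"
      and X: "hang r (X - {r}) {e \<in> E. e \<subseteq> X}"
    have "hang r (insert v (X - {r})) (insert {v, a} {e \<in> E. e \<subseteq> X})"
      by (rule hang.leaf[OF X]) (use *(1,2,3) in auto)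
    moreover have "insert v X - {r} = insert v (X - {r})" using *(1,2) by auto
    ultimately show "hang r (insert v X - {r}) {e \<in> E. e \<subseteq> insert v X}"
      using edges_within_insert[OF sg *(2,3,4,5)] by simp
  qed (use r in auto)
  moreover have "{e \<in> E. e \<subseteq> {..<n}} = E" using sg by (auto simp: sgraph_def)
  ultimately show ?thesis by simp
qed

lemma lambda_min_tree_nonpos:
  assumes tree: "is_tree n E" and q: "1 \<le> q\<^sup>2"
  shows "lambda_min (q_laplacian n E q) \<le> 0"
proof -
  have n: "0 < n" and sg: "sgraph n E"
    using tree by (auto simp: is_tree_def connected_graph_def)
  obtain x where x: "x 0 = 1" "hang_form q ({..<n} - {0}) E x = 0"
    using hang_form_zero[OF tree_hang[OF tree n]] by blast
  have "sq_norm n x = 1 + (\<Sum>v\<in>{..<n} - {0}. (x v)\<^sup>2)"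
    unfolding sq_norm_def using n x by (subst sum.remove[of _ 0]) auto
  \<comment> \<open>Splitting off the root turns the form into the root term plus a sum of squares,
    and \<open>x\<close> was chosen to make that sum vanish.\<close>
  then have "qform q n E x = (1 - q\<^sup>2) + hang_form q ({..<n} - {0}) E x"
    by (simp add: qform_def hang_form_def algebra_simps)
  then have "qform q n E x \<le> 0 * sq_norm n x" using x q by simp
  then show ?thesis using n x by (intro lambda_min_le[OF sg]) (auto intro!: exI[of _ 0])
qed

section \<open>Decomposition of a tree along a path\<close>

definition path_edges :: "nat list \<Rightarrow> edges" where
  "path_edges p = {{p ! i, p ! Suc i} | i. Suc i < length p}"

lemma path_edges_nth: "Suc i < length p \<Longrightarrow> {p ! i, p ! Suc i} \<in> path_edges p"
  by (auto simp: path_edges_def)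

lemma path_edges_subset: "e \<in> path_edges p \<Longrightarrow> e \<subseteq> set p"
  by (auto simp: path_edges_def)

text \<open>Segments of a path, both ends included. They close up to a cycle with a chord, and they
  show the vertex set of a path to be connected.\<close>

lemma is_path_sublist:
  assumes "is_path E p" "i \<le> j" "j < length p"
  shows "path_between E (p ! i) (take (Suc (j - i)) (drop i p)) (p ! j)"
    and "length (take (Suc (j - i)) (drop i p)) = Suc (j - i)"
    and "set (take (Suc (j - i)) (drop i p)) \<subseteq> set p"
proof -
  let ?q = "take (Suc (j - i)) (drop i p)"
  show len: "length ?q = Suc (j - i)" using assms by simp
  show "set ?q \<subseteq> set p" by (meson order.trans set_drop_subset set_take_subset)
  have ne: "?q \<noteq> []" using len by force
  have "successively (\<lambda>x y. {x, y} \<in> E) ?q"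
    unfolding successively_conv_nth len using assms
    by (auto simp: is_path_def successively_conv_nth)
  moreover have "hd ?q = p ! i" using ne assms by (simp add: hd_conv_nth)
  moreover have "last ?q = p ! j" using ne assms len by (simp add: last_conv_nth)
  ultimately show "path_between E (p ! i) ?q (p ! j)"
    using assms ne by (auto simp: path_between_def is_path_def)
qed

lemma path_between_rev: "path_between E a p b \<Longrightarrow> path_between E b (rev p) a"
  by (auto simp: path_between_def is_path_def hd_rev last_rev insert_commute)

text \<open>An edge between nonconsecutive vertices of the path would close a cycle with the segment
  between them.\<close>

lemma edges_within_path:
  assumes tree: "is_tree n E" and p: "is_path E p"
  shows "{e \<in> E. e \<subseteq> set p} = path_edges p"
proof
  show "path_edges p \<subseteq> {e \<in> E. e \<subseteq> set p}"
    using p by (auto simp: path_edges_def is_path_def successively_conv_nth)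
  have sg: "sgraph n E" and ac: "\<nexists>p. is_cycle E p" using tree by (auto simp: is_tree_def)
  have chord: "Suc i = j" if ij: "i < j" "j < length p" "{p ! i, p ! j} \<in> E" for i j
  proof (rule ccontr)
    assume "Suc i \<noteq> j"
    then have "is_cycle E (take (Suc (j - i)) (drop i p))"
      using ij is_path_sublist[OF p, of i j]
      unfolding is_cycle_def path_between_def by (auto simp: insert_commute)
    then show False using ac by blast
  qed
  show "{e \<in> E. e \<subseteq> set p} \<subseteq> path_edges p"
  proof
    fix e assume e: "e \<in> {e \<in> E. e \<subseteq> set p}"
    then have "card e = 2" using sg by (auto simp: sgraph_def)
    then obtain a b where ab: "e = {a, b}" "a \<noteq> b" by (auto simp: card_2_iff)
    then have "a \<in> set p" "b \<in> set p" using e by auto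
    then obtain i j where ij: "i < length p" "j < length p" "a = p ! i" "b = p ! j"
      by (auto simp: in_set_conv_nth)
    then consider "i < j" | "j < i" using ab by (metis nat_neq_iff)
    then show "e \<in> path_edges p"
    proof cases
      case 1
      then show ?thesis using chord[of i j] ij ab e by (auto simp: path_edges_def)
    next
      case 2
      then have "Suc j = i" using chord[of j i] ij ab e by (auto simp: insert_commute)
      then have "e = {p ! j, p ! Suc j}" using ij ab by auto
      then show ?thesis using 2 ij \<open>Suc j = i\<close> by (auto simp: path_edges_def)
    qed
  qed
qed

lemma path_subset:
  assumes "sgraph n E" "is_path E p" "hd p < n"
  shows "set p \<subseteq> {..<n}"
proof
  fix v assume "v \<in> set p"
  then obtain i where i: "i < length p" "v = p ! i" by (auto simp: in_set_conv_nth)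
  show "v \<in> {..<n}"
  proof (cases i)
    \<comment> \<open>The first vertex needs the hypothesis on \<open>hd p\<close>, as a one-vertex
      path has no edge; every later vertex lies on an edge.\<close>
    case 0
    then show ?thesis using assms(2,3) i by (simp add: is_path_def hd_conv_nth)
  next
    case (Suc k)
    then have "{p ! k, v} \<in> E" using assms(2) i by (auto simp: is_path_def successively_conv_nth)
    then show ?thesis using assms(1) by (auto simp: sgraph_def)
  qed
qed

text \<open>The two path neighbours of an internal vertex already exhaust its degree, so nothing
  else can be attached there.\<close>

lemma degree_two_path_neighbour:
  assumes sg: "sgraph n E" and p: "path_between E u p w"
    and a: "a \<in> set p" "a \<noteq> u" "a \<noteq> w" "vdeg E a = 2" and v: "{v, a} \<in> E"
  shows "v \<in> set p"
proof (rule ccontr)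
  assume nv: "v \<notin> set p"
  obtain i where i: "i < length p" "a = p ! i" using a by (auto simp: in_set_conv_nth)
  have pp: "is_path E p" "hd p = u" "last p = w" "p \<noteq> []"
    using p by (auto simp: path_between_def is_path_def)
  have "i \<noteq> 0" using i pp(2,4) a(2) by (metis hd_conv_nth)
  moreover have "Suc i \<noteq> length p" using i pp(3,4) a(3) by (metis diff_Suc_1 last_conv_nth)
  ultimately obtain k where k: "i = Suc k" "Suc (Suc k) < length p"
    using i by (cases i) auto
  have edges: "{p ! k, a} \<in> E" "{a, p ! Suc (Suc k)} \<in> E"
    using pp(1) k i by (auto simp: is_path_def successively_conv_nth)
  have "p ! k \<noteq> p ! Suc (Suc k)"
    using pp(1) k by (auto simp: is_path_def nth_eq_iff_index_eq)
  moreover have "v \<noteq> p ! k" "v \<noteq> p ! Suc (Suc k)" using nv k by auto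
  ultimately have "card {{p ! k, a}, {a, p ! Suc (Suc k)}, {v, a}} = 3"
    by (auto simp: card_insert_if doubleton_eq_iff)
  moreover have "card {{p ! k, a}, {a, p ! Suc (Suc k)}, {v, a}} \<le> vdeg E a"
    unfolding vdeg_def using edges v sgraph_finite[OF sg] by (intro card_mono) auto
  ultimately show False using a(4) by simp
qed

text \<open>The tree is grown from the path. By the degree condition a new vertex is never attached
  at an internal path vertex, so it joins the branch at \<open>u\<close> or the branch at
  \<open>w\<close>.\<close>

lemma shift_decomposition:
  assumes tree: "is_tree n E" and p: "path_between E u p w" and u: "u < n" and uw: "u \<noteq> w"
    and deg: "\<forall>v \<in> set p - {u, w}. vdeg E v = 2"
  obtains A B F G where "hang u A F" "hang w B G" "A \<inter> B = {}" "A \<inter> set p = {}" "B \<inter> set p = {}"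
    "{..<n} = set p \<union> A \<union> B" "E = path_edges p \<union> F \<union> G"
proof -
  have sg: "sgraph n E" using tree by (simp add: is_tree_def)
  have pp: "is_path E p" "hd p = u" "last p = w" "p \<noteq> []" "u \<in> set p" "w \<in> set p"
    using p by (auto simp: path_between_def is_path_def)
  define P where "P X \<longleftrightarrow> (\<exists>A B F G. hang u A F \<and> hang w B G \<and> A \<inter> B = {} \<and> A \<inter> set p = {} \<and>
    B \<inter> set p = {} \<and> X = set p \<union> A \<union> B \<and> {e \<in> E. e \<subseteq> X} = path_edges p \<union> F \<union> G)" for X
  have "P {..<n}"
  proof (rule tree_grow[OF tree, where P = P])
    show "set p \<subseteq> {..<n}" using path_subset[OF sg pp(1)] pp u by simp
    show "set p \<noteq> {}" using pp by simp
    show "\<exists>q. path_between E a q b \<and> set q \<subseteq> set p" if ab: "a \<in> set p" "b \<in> set p" for a b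
    proof -
      obtain i where i: "i < length p" "a = p ! i" 
        using ab(1) unfolding in_set_conv_nth by force
      obtain j where j: "j < length p" "b = p ! j" 
        using ab(2) unfolding in_set_conv_nth by force
      note ij = i(1) j(1) i(2) j(2)
      show ?thesis
      proof (cases "i \<le> j")
        case True
        then show ?thesis using is_path_sublist[OF pp(1), of i j] ij by blast
      next
        case False
        then show ?thesis
          using is_path_sublist[OF pp(1), of j i] ij path_between_rev[of E b _ a]
          by (metis nat_le_linear set_rev)
      qed
    qed
    show "P (set p)"
      unfolding P_def edges_within_path[OF tree pp(1)]
      using hang.empty[of u] hang.empty[of w] by (metis Int_empty_left Un_empty_right)
  next
    fix X v a
    assume X: "set p \<subseteq> X" "v \<notin> X" "a \<in> X" "{v, a} \<in> E" "\<And>b. b \<in> X \<Longrightarrow> {v, b} \<in> E \<Longrightarrow> b = a"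
      and "P X"
    then obtain A B F G where *: "hang u A F" "hang w B G" "A \<inter> B = {}" "A \<inter> set p = {}"
      "B \<inter> set p = {}" "X = set p \<union> A \<union> B" "{e \<in> E. e \<subseteq> X} = path_edges p \<union> F \<union> G"
      unfolding P_def by blast
    have within: "{e \<in> E. e \<subseteq> insert v X} = insert {v, a} {e \<in> E. e \<subseteq> X}"
      by (rule edges_within_insert[OF sg X(2,3,4,5)])
    have v: "v \<notin> set p" "v \<notin> A" "v \<notin> B" "v \<noteq> u" "v \<noteq> w" using X(2) * pp by auto
    have "a \<in> insert u A \<or> a \<in> insert w B"
      using degree_two_path_neighbour[OF sg p, of a v] deg X(3,4) *(6) v(1) by blast
    then show "P (insert v X)"
    proof
      assume "a \<in> insert u A"
      then have "hang u (insert v A) (insert {v, a} F)" by (rule hang.leaf[OF *(1) v(2,4)])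
      then show ?thesis unfolding P_def within using * v
        by (intro exI[of _ "insert v A"] exI[of _ B] exI[of _ "insert {v, a} F"] exI[of _ G]) auto
    next
      assume "a \<in> insert w B"
      then have "hang w (insert v B) (insert {v, a} G)" by (rule hang.leaf[OF *(2) v(3,5)])
      then show ?thesis unfolding P_def within using * v
        by (intro exI[of _ A] exI[of _ "insert v B"] exI[of _ F] exI[of _ "insert {v, a} G"]) auto
    qed
  qed
  moreover have "{e \<in> E. e \<subseteq> {..<n}} = E" using sg by (auto simp: sgraph_def)
  ultimately show ?thesis using that unfolding P_def by auto
qed

text \<open>The reversal is an involution of the positions and permutes the path edges, so the
  path's share of the form does not change under it.\<close>

lemma path_reversal:
  assumes dist: "distinct p"
  obtains \<sigma> where "\<forall>i<length p. \<sigma> (p ! i) = p ! (length p - Suc i)"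
    "bij_betw \<sigma> (set p) (set p)" "(`) \<sigma> ` path_edges p = path_edges p"
proof -
  \<comment> \<open>On a distinct list \<open>inv_into\<close> recovers the position of a
    vertex.\<close>
  define \<sigma> where "\<sigma> v = p ! (length p - Suc (inv_into {..<length p} ((!) p) v))" for v
  have inj: "inj_on ((!) p) {..<length p}" using dist by (simp add: inj_on_nth)
  have nth: "\<sigma> (p ! i) = p ! (length p - Suc i)" if "i < length p" for i
    using inv_into_f_f[OF inj, of i] that by (simp add: \<sigma>_def)
  have invol: "\<sigma> (\<sigma> v) = v \<and> \<sigma> v \<in> set p" if "v \<in> set p" for v
  proof -
    obtain i where i: "i < length p" "v = p ! i" using \<open>v \<in> set p\<close> by (auto simp: in_set_conv_nth)
    then have "length p - Suc i < length p" by simp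
    from nth[OF this] show ?thesis using nth[OF i(1)] i by auto
  qed
  have "bij_betw \<sigma> (set p) (set p)"
    by (rule bij_betw_byWitness[of _ \<sigma>]) (use invol in auto)
  moreover have sub: "\<sigma> ` e \<in> path_edges p" if "e \<in> path_edges p" for e
  proof -
    obtain i where i: "e = {p ! i, p ! Suc i}" "Suc i < length p"
      using \<open>e \<in> path_edges p\<close> by (auto simp: path_edges_def)
    \<comment> \<open>The edge at position \<open>i\<close> goes to the edge at position
      \<open>length p - Suc (Suc i)\<close> with its ends exchanged.\<close>
    then have "\<sigma> ` e = {p ! (length p - Suc (Suc i)), p ! Suc (length p - Suc (Suc i))}"
      using nth[of i] nth[of "Suc i"] by (auto simp: Suc_diff_Suc insert_commute)
    then show ?thesis using i path_edges_nth[of "length p - Suc (Suc i)" p] by simp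
  qed
  have "(`) \<sigma> ` path_edges p = path_edges p"
  proof
    show "path_edges p \<subseteq> (`) \<sigma> ` path_edges p"
    proof
      fix e assume e: "e \<in> path_edges p"
      then have "\<sigma> ` \<sigma> ` e = e"
        using invol path_edges_subset[OF e] by (force simp: image_image)
      then show "e \<in> (`) \<sigma> ` path_edges p" using sub[OF e] by (metis image_eqI)
    qed
  qed (use sub in auto)
  ultimately show ?thesis by (intro that[of \<sigma>] allI impI nth)
qed

section \<open>Effect of a generalized tree shift\<close>

text \<open>In a distinct list the last vertex occurs only at the last position. This singles out
  the one path edge at \<open>w\<close>, which the shift keeps.\<close>

lemma path_edges_last:
  assumes "distinct p" "e \<in> path_edges p" "last p \<in> e"
  shows "e = {last (butlast p), last p}"
proof -
  obtain i where i: "e = {p ! i, p ! Suc i}" "Suc i < length p"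
    using assms(2) by (auto simp: path_edges_def)
  have last: "last p = p ! (length p - 1)" using i by (intro last_conv_nth) auto
  have "last p \<noteq> p ! i" using assms(1) i last by (simp add: nth_eq_iff_index_eq)
  then have "p ! Suc i = last p" using assms(3) i by auto
  then have "Suc i = length p - 1" using assms(1) i last by (simp add: nth_eq_iff_index_eq)
  then have len: "length (butlast p) = Suc i" by simp
  then have "butlast p \<noteq> []" by force
  then have "last (butlast p) = butlast p ! i" using len by (simp add: last_conv_nth)
  also have "\<dots> = p ! i" using len by (simp add: nth_butlast)
  finally show ?thesis using i \<open>p ! Suc i = last p\<close> by simp
qed

text \<open>The edges at \<open>w\<close> that the shift replaces are exactly those of the branch
  \<open>G\<close>, so the shift is the image of \<open>G\<close> under the map sending
  \<open>w\<close> to \<open>u\<close>.\<close>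

lemma gts_step_decomposition:
  assumes "gts_step n S T"
  obtains u w p A B F G where "u \<noteq> w" "path_between S u p w"
    "hang u A F" "hang w B G" "A \<inter> B = {}" "A \<inter> set p = {}" "B \<inter> set p = {}"
    "{..<n} = set p \<union> A \<union> B" "S = path_edges p \<union> F \<union> G"
    "T = path_edges p \<union> F \<union> (`) (\<lambda>v. if v = w then u else v) ` G"
proof -
  have tree: "is_tree n S" using assms by (simp add: gts_step_def)
  obtain u w p where u: "u < n" and uw: "u \<noteq> w" and p: "path_between S u p w"
    and deg: "\<forall>v \<in> set p - {u, w}. vdeg S v = 2"
    and T: "T = (S - {{w, z} | z. {w, z} \<in> S \<and> z \<noteq> last (butlast p)}) \<union>
      {{u, z} | z. {w, z} \<in> S \<and> z \<noteq> last (butlast p)}"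
    using assms unfolding gts_step_def Let_def by auto
  obtain A B F G where D: "hang u A F" "hang w B G" "A \<inter> B = {}" "A \<inter> set p = {}"
    "B \<inter> set p = {}" "{..<n} = set p \<union> A \<union> B" "S = path_edges p \<union> F \<union> G"
    by (rule shift_decomposition[OF tree p u uw deg])
  let ?\<phi> = "\<lambda>v. if v = w then u else v"
  let ?Z = "{z. {w, z} \<in> S \<and> z \<noteq> last (butlast p)}"
  have dist: "distinct p" and last: "last p = w" and wp: "w \<in> set p"
    using p by (auto simp: path_between_def is_path_def)
  have w'p: "last (butlast p) \<in> set p"
  proof -
    have "butlast p \<noteq> []" using p uw
      by (cases p) (auto simp: path_between_def is_path_def split: if_splits)
    then show ?thesis by (meson in_set_butlastD last_in_set)
  qed
  have wF: "w \<notin> e" if "e \<in> F" for e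
    using hang_edge[OF D(1) that] D(4) wp uw by blast
  have Z: "z \<in> ?Z \<longleftrightarrow> {w, z} \<in> G" for z
  proof
    assume z: "z \<in> ?Z"
    then have "{w, z} \<notin> path_edges p"
      using path_edges_last[OF dist, of "{w, z}"] last by (auto simp: doubleton_eq_iff)
    then show "{w, z} \<in> G" using z D(7) wF[of "{w, z}"] by auto
  next
    assume z: "{w, z} \<in> G"
    then have "z \<in> B" using hang_edge[OF D(2) z] hang_root[OF D(2)] by auto
    then show "z \<in> ?Z" using z D(5,7) w'p by auto
  qed
  have G_cases: "(\<exists>z. e = {w, z} \<and> z \<noteq> w \<and> {w, z} \<in> G) \<or> w \<notin> e" if "e \<in> G" for e
  proof -
    have "card e = 2" using hang_edge[OF D(2) that] by simp
    then show ?thesis using that by (auto simp: card_2_iff insert_commute)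
  qed
  have G_image: "(`) ?\<phi> ` G = {e \<in> G. w \<notin> e} \<union> {{u, z} | z. {w, z} \<in> G}"
  proof -
    have 1: "?\<phi> ` e = e" if "w \<notin> e" for e
    proof -
      have "?\<phi> ` e = id ` e" using that by (intro image_cong) auto
      then show ?thesis by simp
    qed
    have 2: "?\<phi> ` {w, z} = {u, z}" if "{w, z} \<in> G" for z
      using hang_edge[OF D(2) that] hang_root[OF D(2)] by auto
    show ?thesis
    proof (intro equalityI subsetI)
      fix e assume "e \<in> (`) ?\<phi> ` G"
      then obtain e' where e': "e' \<in> G" "e = ?\<phi> ` e'" by blast
      from G_cases[OF e'(1)] show "e \<in> {e \<in> G. w \<notin> e} \<union> {{u, z} | z. {w, z} \<in> G}"
      proof
        assume "\<exists>z. e' = {w, z} \<and> z \<noteq> w \<and> {w, z} \<in> G"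
        then obtain z where z: "e' = {w, z}" "{w, z} \<in> G" by blast
        then have "e = {u, z}" using 2[of z] e' by simp
        then show ?thesis using z by blast
      next
        assume "w \<notin> e'"
        then show ?thesis using 1[of e'] e' by simp
      qed
    next
      fix e assume "e \<in> {e \<in> G. w \<notin> e} \<union> {{u, z} | z. {w, z} \<in> G}"
      then show "e \<in> (`) ?\<phi> ` G"
      proof
        assume "e \<in> {e \<in> G. w \<notin> e}"
        then show ?thesis using 1[of e] by (intro image_eqI[of _ _ e]) auto
      next
        assume "e \<in> {{u, z} | z. {w, z} \<in> G}"
        then obtain z where "e = {u, z}" "{w, z} \<in> G" by blast
        then show ?thesis using 2[of z] by (intro image_eqI[of _ _ "{w, z}"]) auto
      qed
    qed
  qed
  \<comment> \<open>Such an edge has its other end in \<open>B\<close>, so removing it touches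
    neither the path nor \<open>F\<close>.\<close>
  have keep: "{w, z} \<notin> path_edges p \<and> {w, z} \<notin> F" if "{w, z} \<in> G" for z
  proof -
    have "z \<in> B" using hang_edge[OF D(2) that] hang_root[OF D(2)] by auto
    then show ?thesis using D(5) path_edges_subset[of "{w, z}" p] wF[of "{w, z}"] by auto
  qed
  have "S - {{w, z} | z. {w, z} \<in> G} = path_edges p \<union> F \<union> {e \<in> G. w \<notin> e}"
    unfolding D(7) using keep G_cases by blast
  moreover have "T = (S - {{w, z} | z. {w, z} \<in> G}) \<union> {{u, z} | z. {w, z} \<in> G}"
    using T Z by simp
  ultimately have "T = path_edges p \<union> F \<union> (`) ?\<phi> ` G"
    unfolding G_image by blast
  then show ?thesis using that[of u w p A F B G] uw p D by blast
qed

lemma lambda_min_gts_step: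
  assumes step: "gts_step n S T" and q: "1 \<le> q\<^sup>2"
  shows "lambda_min (q_laplacian n T q) \<le> lambda_min (q_laplacian n S q)"
proof -
  have tree: "is_tree n S" using step by (simp add: gts_step_def)
  then have sgS: "sgraph n S" and n: "n > 0" by (auto simp: is_tree_def connected_graph_def)
  obtain u w p A B F G where uw: "u \<noteq> w" and p: "path_between S u p w"
    and D: "hang u A F" "hang w B G" "A \<inter> B = {}" "A \<inter> set p = {}" "B \<inter> set p = {}"
      "{..<n} = set p \<union> A \<union> B" "S = path_edges p \<union> F \<union> G"
    and T: "T = path_edges p \<union> F \<union> (`) (\<lambda>v. if v = w then u else v) ` G"
    by (rule gts_step_decomposition[OF step])
  define \<phi> where "\<phi> v = (if v = w then u else v)" for v
  have T: "T = path_edges p \<union> F \<union> (`) \<phi> ` G" unfolding T \<phi>_def ..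
  have dist: "distinct p" and up: "u \<in> set p" and wp: "w \<in> set p" and ends: "hd p = u" "last p = w"
    and ne: "p \<noteq> []"
    using p by (auto simp: path_between_def is_path_def)
  have B: "u \<notin> B" "w \<notin> B" and A: "u \<notin> A" "w \<notin> A" using D(4,5) up wp by auto
  have \<phi>B: "\<phi> v = v" if "v \<in> B" for v using that B by (auto simp: \<phi>_def)
  \<comment> \<open>Injective only because \<open>u\<close> lies outside \<open>B\<close>; on the
    whole vertex set \<phi> identifies \<open>u\<close> and \<open>w\<close>.\<close>
  have \<phi>inj: "inj_on \<phi> (insert w B)" using B by (auto simp: inj_on_def \<phi>_def)
  have \<phi>edge: "\<phi> ` e \<subseteq> insert u B \<and> card (\<phi> ` e) = 2 \<and> \<phi> ` e \<inter> B \<noteq> {}" if "e \<in> G" for e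
  proof -
    have e: "e \<subseteq> insert w B" "card e = 2" "e \<inter> B \<noteq> {}" using hang_edge[OF D(2) that] by auto
    have "card (\<phi> ` e) = 2" using card_image[OF inj_on_subset[OF \<phi>inj e(1)]] e(2) by simp
    moreover have "\<phi> ` e \<subseteq> insert u B" using e(1) by (auto simp: \<phi>_def)
    moreover obtain v where "v \<in> e" "v \<in> B" using e(3) by blast
    ultimately show ?thesis using \<phi>B[of v] by (metis disjoint_iff imageI)
  qed
  have sgT: "sgraph n T"
    unfolding sgraph_def
  proof
    fix e assume "e \<in> T"
    then consider "e \<in> S" | e' where "e' \<in> G" "e = \<phi> ` e'" unfolding T D(7) by blast
    then show "e \<subseteq> {..<n} \<and> card e = 2"
    proof cases
      case 1
      then show ?thesis using sgS by (simp add: sgraph_def)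
    next
      case 2
      then show ?thesis using \<phi>edge[OF 2(1)] D(6) up by blast
    qed
  qed
  have fin: "finite A" "finite F" "finite B" "finite G" "finite (path_edges p)"
    using hang_finite[OF D(1)] hang_finite[OF D(2)] sgraph_finite[OF sgS] D(7) by auto
  define N where "N C x = (\<Sum>v\<in>C. (x v)\<^sup>2)" for C and x :: "nat \<Rightarrow> real"
  define pf where "pf x = (1 - q\<^sup>2) * N (set p) x + (\<Sum>e\<in>path_edges p. edge_form q x e)" for x
  have norm: "sq_norm n x = N (set p) x + N A x + N B x" for x
    unfolding sq_norm_def N_def D(6) using fin D(3,4,5)
    by (subst sum.union_disjoint; (subst sum.union_disjoint)?) auto
  have pB: "e \<inter> B = {}" if "e \<in> path_edges p" for e
    using path_edges_subset[OF that] D(5) by blast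
  have FB: "e \<inter> B = {}" if "e \<in> F" for e
  proof -
    have "e \<subseteq> insert u A" using hang_edge[OF D(1) that] by simp
    then show ?thesis using D(3) B by blast
  qed
  have GB: "e \<inter> B \<noteq> {}" if "e \<in> G" for e using hang_edge[OF D(2) that] by simp
  have pF: "path_edges p \<inter> F = {}"
    using hang_edge[OF D(1)] path_edges_subset[of _ p] D(4) by blast
  have \<phi>GB: "e \<inter> B \<noteq> {}" if "e \<in> (`) \<phi> ` G" for e using \<phi>edge that by auto
  \<comment> \<open>Meeting \<open>B\<close> separates the edges of the branch at \<open>w\<close>,
    before and after the shift, from all others.\<close>
  have disj: "X \<inter> Y = {}"
    if "\<And>e. e \<in> X \<Longrightarrow> e \<inter> B = {}" "\<And>e. e \<in> Y \<Longrightarrow> e \<inter> B \<noteq> {}" for X Y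
    by (rule equals0I) (metis IntD1 IntD2 that)
  have pG: "path_edges p \<inter> G = {}" and FG: "F \<inter> G = {}"
    and pG': "path_edges p \<inter> (`) \<phi> ` G = {}" and FG': "F \<inter> (`) \<phi> ` G = {}"
    by (rule disj[OF pB GB] disj[OF FB GB] disj[OF pB \<phi>GB] disj[OF FB \<phi>GB]; assumption)+
  have formS: "qform q n S x = pf x + hang_form q A F x + hang_form q B G x" for x
  proof -
    have "(\<Sum>e\<in>S. edge_form q x e) = (\<Sum>e\<in>path_edges p. edge_form q x e)
        + (\<Sum>e\<in>F. edge_form q x e) + (\<Sum>e\<in>G. edge_form q x e)"
      unfolding D(7) using fin pF pG FG by (simp add: sum.union_disjoint Int_Un_distrib2)
    then show ?thesis
      by (simp add: qform_def norm pf_def hang_form_def N_def algebra_simps)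
  qed
  \<comment> \<open>After the shift the branch on \<open>B\<close> reads the value of
    \<open>x\<close> at \<open>u\<close> where it formerly read the value at
    \<open>w\<close>.\<close>
  have formT: "qform q n T x = pf x + hang_form q A F x + hang_form q B G (x \<circ> \<phi>)" for x
  proof -
    have "\<Union>G \<subseteq> insert w B" using hang_edge[OF D(2)] by blast
    then have "(\<Sum>e\<in>(`) \<phi> ` G. edge_form q x e) = (\<Sum>e\<in>G. edge_form q (x \<circ> \<phi>) e)"
      by (intro sum_edge_form_image inj_on_subset[OF \<phi>inj])
    moreover have "(\<Sum>e\<in>T. edge_form q x e) = (\<Sum>e\<in>path_edges p. edge_form q x e)
        + (\<Sum>e\<in>F. edge_form q x e) + (\<Sum>e\<in>(`) \<phi> ` G. edge_form q x e)"
      unfolding T using fin pF pG' FG' by (simp add: sum.union_disjoint Int_Un_distrib2)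
    moreover have "N B (\<lambda>v. x (\<phi> v)) = N B x" unfolding N_def using \<phi>B by simp
    ultimately show ?thesis
      by (simp add: qform_def norm pf_def hang_form_def N_def[symmetric] algebra_simps)
  qed
  obtain x where x: "\<exists>i<n. x i \<noteq> 0"
    and attained: "qform q n S x = lambda_min (q_laplacian n S q) * sq_norm n x"
    by (rule lambda_min_attained[OF n sgS])
  let ?\<mu> = "lambda_min (q_laplacian n S q)"
  have \<mu>: "?\<mu> \<le> 0" using tree q by (rule lambda_min_tree_nonpos)
  have eq: "pf x + hang_form q A F x + hang_form q B G x = ?\<mu> * (N (set p) x + N A x + N B x)"
    using attained unfolding formS norm .
  \<comment> \<open>Here \<open>h\<close> is the form of a branch and \<open>m\<close> its squared
    norm; \<open>h - ?\<mu> * m\<close> is nonnegative because \<mu> is nonpositive.\<close>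
  have shrink: "t\<^sup>2 * (h - ?\<mu> * m) \<le> h - ?\<mu> * m" if "t\<^sup>2 \<le> 1" "0 \<le> h" "0 \<le> m" for t h m :: real
  proof -
    have "?\<mu> * m \<le> 0" using \<mu> that(3) by (rule mult_nonpos_nonneg)
    then have "0 \<le> h - ?\<mu> * m" using that(2) by linarith
    then show ?thesis using mult_right_mono[OF that(1)] by fastforce
  qed
  have NN: "0 \<le> N C x" for C unfolding N_def by (simp add: sum_nonneg)
  show ?thesis
  proof (cases "\<bar>x u\<bar> \<le> \<bar>x w\<bar>")
    case True
    \<comment> \<open>If \<open>x w = 0\<close>, the case assumption forces \<open>x u = 0\<close>
      as well; the default 1 then leaves \<open>x\<close> unchanged, so \<open>y\<close> stays
      nonzero.\<close>
    define t where "t = (if x w = 0 then 1 else x u / x w)"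
    have t: "x u = t * x w" using True by (auto simp: t_def)
    have "t\<^sup>2 \<le> 1" using True by (auto simp: t_def abs_square_le_1 divide_le_eq)
    define y where "y v = (if v \<in> B then t * x v else x v)" for v
    have yp: "y v = x v" if "v \<in> set p \<union> insert u A" for v
      using that D(3,5) B up by (auto simp: y_def)
    have "pf y = pf x"
      unfolding pf_def N_def using yp path_edges_subset[of _ p]
      by (intro arg_cong2[of _ _ _ _ "(+)"] arg_cong2[of _ _ _ _ "(*)"] sum.cong edge_form_cong refl)
        (auto simp: subset_iff)
    moreover have "hang_form q A F y = hang_form q A F x"
      using yp by (intro hang_form_cong[OF D(1)]) auto
    \<comment> \<open>At the root \<open>w\<close> the composite takes the value
      \<open>y u = x u = t * x w\<close>, so the scaling is consistent along the attaching
      edges.\<close>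
    moreover have "hang_form q B G (y \<circ> \<phi>) = hang_form q B G (\<lambda>v. t * x v)"
      using B t \<phi>B by (intro hang_form_cong[OF D(2)]) (auto simp: y_def \<phi>_def)
    ultimately have "qform q n T y = pf x + hang_form q A F x + t\<^sup>2 * hang_form q B G x"
      unfolding formT hang_form_scale[OF D(2)] by simp
    moreover have "sq_norm n y = N (set p) x + N A x + t\<^sup>2 * N B x"
    proof -
      have "N (set p) y = N (set p) x" "N A y = N A x" unfolding N_def using yp by auto
      moreover have "N B y = t\<^sup>2 * N B x"
        by (simp add: N_def y_def power_mult_distrib sum_distrib_left)
      ultimately show ?thesis by (simp add: norm)
    qed
    moreover have "t\<^sup>2 * (hang_form q B G x - ?\<mu> * N B x) \<le> hang_form q B G x - ?\<mu> * N B x"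
      using \<open>t\<^sup>2 \<le> 1\<close> hang_form_nonneg[OF D(2)] NN by (rule shrink)
    ultimately have "qform q n T y \<le> ?\<mu> * sq_norm n y"
      using eq by (simp add: algebra_simps)
    moreover have "\<exists>i<n. y i \<noteq> 0"
    proof (cases "x w = 0")
      case True
      then have "y = x" by (auto simp: y_def t_def)
      then show ?thesis using x by simp
    next
      case False
      moreover have "w < n" using D(6) wp by auto
      ultimately show ?thesis using yp[of w] wp by auto
    qed
    ultimately show ?thesis by (intro lambda_min_le[OF sgT])
  next
    case False
    \<comment> \<open>In this case \<open>x u\<close> is nonzero.\<close>
    define t where "t = x w / x u"
    have t: "x w = t * x u" and "t\<^sup>2 \<le> 1"
      using False by (auto simp: t_def abs_square_le_1 divide_le_eq)
    obtain \<sigma> where nth: "\<forall>i<length p. \<sigma> (p ! i) = p ! (length p - Suc i)"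
      and bij: "bij_betw \<sigma> (set p) (set p)" and img: "(`) \<sigma> ` path_edges p = path_edges p"
      by (rule path_reversal[OF dist])
    have \<sigma>u: "\<sigma> u = w" using nth[rule_format, of 0] ends ne by (simp add: hd_conv_nth last_conv_nth)
    have \<sigma>w: "\<sigma> w = u" using nth[rule_format, of "length p - 1"] ends ne by (simp add: hd_conv_nth last_conv_nth)
    \<comment> \<open>The reversed path carries \<open>x w\<close> at \<open>u\<close>. Both
      branches of the shifted tree hang there: \<open>B\<close> fits unscaled, and \<open>A\<close>,
      which formerly read \<open>x u\<close>, fits after scaling by \<open>t\<close>.\<close>
    define y where "y v = (if v \<in> A then t * x v else if v \<in> B then x v else x (\<sigma> v))" for v
    have yp: "y v = x (\<sigma> v)" if "v \<in> set p" for v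
      using that D(4,5) by (auto simp: y_def)
    have Np: "N (set p) y = N (set p) x"
    proof -
      have "N (set p) y = (\<Sum>v\<in>set p. (x (\<sigma> v))\<^sup>2)" using yp by (simp add: N_def)
      also have "\<dots> = N (set p) x" unfolding N_def using bij by (rule sum.reindex_bij_betw)
      finally show ?thesis .
    qed
    have "(\<Sum>e\<in>path_edges p. edge_form q y e) = (\<Sum>e\<in>path_edges p. edge_form q (x \<circ> \<sigma>) e)"
    proof (intro sum.cong edge_form_cong refl)
      fix e v assume "e \<in> path_edges p" "v \<in> e"
      then have "v \<in> set p" using path_edges_subset by blast
      then show "y v = (x \<circ> \<sigma>) v" by (simp add: yp)
    qed
    also have "\<dots> = (\<Sum>e\<in>(`) \<sigma> ` path_edges p. edge_form q x e)"
    proof (rule sum_edge_form_image[symmetric])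
      have "\<Union>(path_edges p) \<subseteq> set p" using path_edges_subset by blast
      then show "inj_on \<sigma> (\<Union>(path_edges p))"
        using bij by (auto simp: bij_betw_def intro: inj_on_subset)
    qed
    finally have "pf y = pf x" unfolding img pf_def Np by simp
    moreover have "hang_form q A F y = t\<^sup>2 * hang_form q A F x"
      unfolding hang_form_scale[OF D(1), symmetric]
      using A t \<sigma>u B by (intro hang_form_cong[OF D(1)]) (auto simp: y_def)
    moreover have "hang_form q B G (y \<circ> \<phi>) = hang_form q B G x"
      using A B \<sigma>u D(3) \<phi>B by (intro hang_form_cong[OF D(2)]) (auto simp: y_def \<phi>_def)
    ultimately have "qform q n T y = pf x + t\<^sup>2 * hang_form q A F x + hang_form q B G x"
      unfolding formT by simp
    moreover have "sq_norm n y = N (set p) x + t\<^sup>2 * N A x + N B x"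
    proof -
      have "N A y = t\<^sup>2 * N A x"
        by (simp add: N_def y_def power_mult_distrib sum_distrib_left)
      moreover have "N B y = N B x" unfolding N_def using D(3) by (intro sum.cong) (auto simp: y_def)
      ultimately show ?thesis by (simp add: norm Np)
    qed
    moreover have "t\<^sup>2 * (hang_form q A F x - ?\<mu> * N A x) \<le> hang_form q A F x - ?\<mu> * N A x"
      using \<open>t\<^sup>2 \<le> 1\<close> hang_form_nonneg[OF D(1)] NN by (rule shrink)
    ultimately have "qform q n T y \<le> ?\<mu> * sq_norm n y"
      using eq by (simp add: algebra_simps)
    moreover have "w < n" using D(6) wp by blast
    \<comment> \<open>The reversal puts the nonzero value \<open>x u\<close> at
      \<open>w\<close>.\<close>
    moreover have "y w \<noteq> 0" using yp[OF wp] \<sigma>w False by auto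
    ultimately show ?thesis using lambda_min_le[OF sgT] by blast
  qed
qed

section \<open>Invariance under isomorphism and conclusion\<close>

lemma lambda_min_tree_iso:
  assumes "(S, T) \<in> tree_iso n"
  shows "lambda_min (q_laplacian n T q) = lambda_min (q_laplacian n S q)"
proof -
  \<comment> \<open>One inequality suffices, since isomorphism is symmetric; it comes from pulling
    an optimal vector of \<open>T\<close> back along the isomorphism.\<close>
  have le: "lambda_min (q_laplacian n S q) \<le> lambda_min (q_laplacian n T q)"
    if ST: "(S, T) \<in> tree_iso n" for S T
  proof -
    obtain f where sg: "sgraph n S" "sgraph n T" and n: "n > 0"
      and f: "bij_betw f {..<n} {..<n}" and T: "T = (`) f ` S"
      using ST by (auto simp: tree_iso_def is_tree_def connected_graph_def)
    obtain x where x: "\<exists>i<n. x i \<noteq> 0"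
      and att: "qform q n T x = lambda_min (q_laplacian n T q) * sq_norm n x"
      by (rule lambda_min_attained[OF n sg(2)])
    have norm: "sq_norm n (x \<circ> f) = sq_norm n x"
      unfolding sq_norm_def comp_def using f by (rule sum.reindex_bij_betw)
    have "\<Union>S \<subseteq> {..<n}" using sg(1) by (auto simp: sgraph_def)
    then have "qform q n S (x \<circ> f) = qform q n T x"
      unfolding qform_def T norm using f
      by (subst sum_edge_form_image) (auto simp: bij_betw_def intro: inj_on_subset)
    then have "qform q n S (x \<circ> f) \<le> lambda_min (q_laplacian n T q) * sq_norm n (x \<circ> f)"
      unfolding norm using att by simp
    moreover have "\<exists>i<n. (x \<circ> f) i \<noteq> 0"
      using x norm sq_norm_pos_iff[of n x] sq_norm_pos_iff[of n "x \<circ> f"] by simp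
    ultimately show ?thesis by (intro lambda_min_le[OF sg(1)])
  qed
  have "(T, S) \<in> tree_iso n" using equiv_tree_iso assms by (meson equivE symE)
  then show ?thesis using le[OF assms] le[of T S] by simp
qed

theorem theorem6p6:
  fixes n :: nat and T1 T2 :: edges
  assumes "is_tree n T1" and "is_tree n T2"
    and "gts_covers n (iso_class n T2) (iso_class n T1)"
  shows "\<forall>q::real. \<bar>q\<bar> > 1 \<longrightarrow>
           lambda_min (q_laplacian n T1 q) \<ge> lambda_min (q_laplacian n T2 q)"
proof (intro allI impI)
  fix q :: real assume "\<bar>q\<bar> > 1"
  then have q: "1 \<le> q\<^sup>2" using one_le_power[of "\<bar>q\<bar>" 2] by simp
  \<comment> \<open>The order on classes only provides some representatives joined by shifts, so
    \<open>T1\<close> and \<open>T2\<close> are replaced by isomorphic trees \<open>S\<close> and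
    \<open>T\<close>.\<close>
  obtain S T where S: "(T1, S) \<in> tree_iso n" and T: "(T2, T) \<in> tree_iso n"
    and steps: "(gts_step n)\<^sup>*\<^sup>* S T"
    using assms(3) by (auto simp: gts_covers_def gts_le_def iso_class_def)
  from steps have "lambda_min (q_laplacian n T q) \<le> lambda_min (q_laplacian n S q)"
  proof (induction rule: rtranclp_induct)
    case (step T U)
    then show ?case using lambda_min_gts_step[OF step.hyps(2) q] by linarith
  qed simp
  then show "lambda_min (q_laplacian n T1 q) \<ge> lambda_min (q_laplacian n T2 q)"
    using lambda_min_tree_iso[OF S] lambda_min_tree_iso[OF T] by simp
qed

end
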